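(* Let $\phi\in\mathcal{A}$, and let $f_j=h_j+\overline{g_j}\in\mathcal{S}_{\mathcal H}^0$ $(j=1,2)$ with $f_j\in\mathcal{W}_{\mathcal H}^{-1}(\phi)$, i.e. $h_j-g_j=\phi$ for $j=1,2$. If $\phi$ is convex in the direction of the real axis, then $f_3=tf_1+(1-t)f_2$ $(0\le t\le 1)$ is univalent and convex in the direction of the real axis.
   Context: $\mathbb{D}=\{z\in\mathbb{C}:|z|<1\}$. $\mathcal H$ is the class of complex-valued harmonic functions $f$ in $\mathbb D$ with $f(0)=f_{\bar z}(0)=f_z(0)-1=0$; each is written $f=h+\overline g$ with $h(z)=z+\sum_{n\ge2}a_nz^n$ and $g(z)=\sum_{n\ge2}b_nz^n$ analytic in $\mathbb D$. $\mathcal S_{\mathcal H}^0$ is the subclass of $\mathcal H$ of univalent, sense-preserving functions (a function in $\mathcal H$ is locally univalent and sense-preserving if and only if $|g'|<|h'|$ in $\mathbb D$). $\mathcal A$ is the subclass of $\mathcal H$ of normalized analytic functions. For $\phi\in\mathcal A$ and $|\lambda|=1$, $\mathcal W_{\mathcal H}^\lambda(\phi)=\{h+\overline g\in\mathcal H: h+\lambda g=\phi\}$. A domain is convex in the direction of the real axis if its intersection with each horizontal line is connected or empty; a function in $\mathcal H$ is convex in the direction of the real axis if it maps $\mathbb D$ onto such a domain.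
   Formalization: The formal statement additionally assumes that φ is univalent in the disc; if convexity in the direction of the real axis is read only as a condition on the image φ(D), the claim fails for some non-univalent φ, even with f_1=f_2. *)

theory Defs
  imports "HOL-Complex_Analysis.Complex_Analysis"
begin

abbreviation unit_disc :: "complex set" where
  "unit_disc \<equiv> ball 0 1"

definition partial_x :: "(complex \<Rightarrow> complex) \<Rightarrow> complex \<Rightarrow> complex" where
  "partial_x f z = vector_derivative (\<lambda>t::real. f (z + of_real t)) (at 0)"

definition partial_y :: "(complex \<Rightarrow> complex) \<Rightarrow> complex \<Rightarrow> complex" where
  "partial_y f z = vector_derivative (\<lambda>t::real. f (z + \<i> * of_real t)) (at 0)"

definition wirtinger_z :: "(complex \<Rightarrow> complex) \<Rightarrow> complex \<Rightarrow> complex" where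
  "wirtinger_z f z = (partial_x f z - \<i> * partial_y f z) / 2"

definition wirtinger_zbar :: "(complex \<Rightarrow> complex) \<Rightarrow> complex \<Rightarrow> complex" where
  "wirtinger_zbar f z = (partial_x f z + \<i> * partial_y f z) / 2"

(* differentiable_on is real differentiability here: the class is C^2, not holomorphic. *)
definition twice_cont_differentiable_on :: "(complex \<Rightarrow> complex) \<Rightarrow> complex set \<Rightarrow> bool" where
  "twice_cont_differentiable_on f S \<longleftrightarrow>
     f differentiable_on S \<and>
     partial_x f differentiable_on S \<and> partial_y f differentiable_on S \<and>
     continuous_on S (partial_x (partial_x f)) \<and> continuous_on S (partial_x (partial_y f)) \<and>
     continuous_on S (partial_y (partial_x f)) \<and> continuous_on S (partial_y (partial_y f))"

definition harmonic_on :: "(complex \<Rightarrow> complex) \<Rightarrow> complex set \<Rightarrow> bool" where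
  "harmonic_on f S \<longleftrightarrow> open S \<and> twice_cont_differentiable_on f S \<and>
     (\<forall>z\<in>S. partial_x (partial_x f) z + partial_y (partial_y f) z = 0)"

definition class_H :: "(complex \<Rightarrow> complex) set" where
  "class_H = {f. harmonic_on f unit_disc \<and>
     f 0 = 0 \<and> wirtinger_zbar f 0 = 0 \<and> wirtinger_z f 0 - 1 = 0}"

(* The normalisations say that the power series of h is z + O(z^2) and that of g is O(z^2). *)
definition canonical_rep ::
  "(complex \<Rightarrow> complex) \<Rightarrow> (complex \<Rightarrow> complex) \<Rightarrow> (complex \<Rightarrow> complex) \<Rightarrow> bool" where
  "canonical_rep f h g \<longleftrightarrow>
     h holomorphic_on unit_disc \<and> g holomorphic_on unit_disc \<and>
     h 0 = 0 \<and> deriv h 0 = 1 \<and> g 0 = 0 \<and> deriv g 0 = 0 \<and>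
     (\<forall>z\<in>unit_disc. f z = h z + cnj (g z))"

(* The Jacobian is |f_z|^2 - |f_zbar|^2; for f = h + cnj g this condition is |g'| < |h'|. *)
definition sense_preserving_on :: "(complex \<Rightarrow> complex) \<Rightarrow> complex set \<Rightarrow> bool" where
  "sense_preserving_on f S \<longleftrightarrow> (\<forall>z\<in>S. cmod (wirtinger_zbar f z) < cmod (wirtinger_z f z))"

definition class_SH0 :: "(complex \<Rightarrow> complex) set" where
  "class_SH0 = {f \<in> class_H. inj_on f unit_disc \<and> sense_preserving_on f unit_disc}"

definition class_A :: "(complex \<Rightarrow> complex) set" where
  "class_A = {f \<in> class_H. f holomorphic_on unit_disc}"

definition class_W :: "complex \<Rightarrow> (complex \<Rightarrow> complex) \<Rightarrow> (complex \<Rightarrow> complex) set" where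
  "class_W c \<phi> = {f \<in> class_H.
     \<exists>h g. canonical_rep f h g \<and> (\<forall>z\<in>unit_disc. h z + c * g z = \<phi> z)}"

definition domain_convex_real_dir :: "complex set \<Rightarrow> bool" where
  "domain_convex_real_dir \<Omega> \<longleftrightarrow> open \<Omega> \<and> connected \<Omega> \<and> \<Omega> \<noteq> {} \<and>
     (\<forall>y::real. connected (\<Omega> \<inter> {w. Im w = y}))"

definition convex_real_dir :: "(complex \<Rightarrow> complex) \<Rightarrow> bool" where
  "convex_real_dir f \<longleftrightarrow> domain_convex_real_dir (f ` unit_disc)"

end

theory Submission
  imports Defs
begin

text \<open>
  Put \<open>g = t g\<^sub>1 + (1 - t) g\<^sub>2\<close>. Since \<open>h\<^sub>j - g\<^sub>j = \<phi>\<close>, we have \<open>f\<^sub>3 = \<phi> + 2 Re g\<close>, so that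
  \<open>f\<^sub>3 \<circ> \<phi>\<inverse>\<close> is a horizontal shear \<open>w \<mapsto> w + 2 Re (G w)\<close> of the domain \<open>\<phi> ` \<bbbD>\<close>, with
  \<open>G = g \<circ> \<phi>\<inverse>\<close>. The condition \<open>|g\<^sub>j'| < |h\<^sub>j'|\<close> reads \<open>|\<phi>'|\<^sup>2 + 2 Re (cnj \<phi>' g\<^sub>j') > 0\<close>, which is
  affine in \<open>g\<^sub>j'\<close> and hence holds for \<open>g'\<close> as well. It says exactly that the shear is strictly
  increasing along every horizontal section of \<open>\<phi> ` \<bbbD>\<close>, and these sections are intervals.
\<close>

text \<open>The derivative of \<open>h + cnj g\<close> in direction \<open>c\<close> is
  \<open>c h' + cnj c * cnj g'\<close>. Taking \<open>c = 1\<close> and \<open>c = \<i>\<close>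
  gives both partial derivatives, and the Wirtinger combinations separate the two terms. This turns
  \<open>sense_preserving_on\<close> into \<open>|g'| < |h'|\<close>.\<close>

lemma wirtinger_canonical_rep:
  assumes rep: "canonical_rep f h g" and z: "z \<in> unit_disc"
  shows "wirtinger_z f z = deriv h z" "wirtinger_zbar f z = cnj (deriv g z)"
proof -
  have hol: "h holomorphic_on unit_disc" "g holomorphic_on unit_disc"
    and f: "\<And>w. w \<in> unit_disc \<Longrightarrow> f w = h w + cnj (g w)"
    using rep by (auto simp: canonical_rep_def)
  have h': "(h has_field_derivative deriv h z) (at z)"
    and g': "(g has_field_derivative deriv g z) (at z)"
    using hol z by (auto intro: holomorphic_derivI)
  have dir: "vector_derivative (\<lambda>s::real. f (z + c * of_real s)) (at 0)
               = c * deriv h z + cnj (c * deriv g z)" for c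
  proof (rule vector_derivative_at)
    have line: "((\<lambda>s::real. z + c * of_real s) has_vector_derivative c) (at 0)"
      by (auto intro!: derivative_eq_intros)
    have "((h \<circ> (\<lambda>s::real. z + c * of_real s)) has_vector_derivative c * deriv h z) (at 0)"
         "((g \<circ> (\<lambda>s::real. z + c * of_real s)) has_vector_derivative c * deriv g z) (at 0)"
      using line h' g' by (auto intro!: field_vector_diff_chain_at)
    then have D: "((\<lambda>s::real. h (z + c * of_real s) + cnj (g (z + c * of_real s)))
        has_vector_derivative c * deriv h z + cnj (c * deriv g z)) (at 0)"
      unfolding o_def by (intro has_vector_derivative_add has_vector_derivative_cnj)
    \<comment> \<open>The formula for \<open>f\<close> holds only on the disc, so the derivative is
      transferred from a neighbourhood of 0 on which the line stays inside.\<close>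
    have op: "open ((\<lambda>s::real. z + c * of_real s) -` unit_disc)"
      by (intro open_vimage continuous_intros) auto
    show "((\<lambda>s::real. f (z + c * of_real s)) has_vector_derivative
        c * deriv h z + cnj (c * deriv g z)) (at 0)"
      by (rule has_vector_derivative_transform_within_open[OF D op]) (use z f in auto)
  qed
  have x: "partial_x f z = deriv h z + cnj (deriv g z)"
    using dir[of 1] by (simp add: partial_x_def)
  have y: "partial_y f z = \<i> * deriv h z + cnj (\<i> * deriv g z)"
    using dir[of \<i>] by (simp add: partial_y_def)
  show "wirtinger_z f z = deriv h z" "wirtinger_zbar f z = cnj (deriv g z)"
    unfolding wirtinger_z_def wirtinger_zbar_def x y by (simp_all add: algebra_simps)
qed

text \<open>Squaring cancels \<open>|v|^2\<close>, which leaves a condition that is real-affine in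
  \<open>v\<close>. It is applied with \<open>u = \<phi>'\<close> and \<open>v = g'\<close>, so that
  \<open>u + v = h'\<close>.\<close>

lemma norm_less_norm_add_iff:
  fixes u v :: complex
  shows "cmod v < cmod (u + v) \<longleftrightarrow> 0 < (cmod u)\<^sup>2 + 2 * Re (cnj u * v)"
proof -
  have "cmod v < cmod (u + v) \<longleftrightarrow> (cmod v)\<^sup>2 < (cmod (u + v))\<^sup>2"
    by (meson norm_ge_zero pos2 power2_less_imp_less power_strict_mono)
  moreover have "(cmod (u + v))\<^sup>2 = (cmod v)\<^sup>2 + ((cmod u)\<^sup>2 + 2 * Re (cnj u * v))"
    unfolding cmod_power2 by (simp add: power2_eq_square algebra_simps)
  ultimately show ?thesis
    by linarith
qed

text \<open>The two sides differ by the factor \<open>|u|^2\<close>. The quotient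
  \<open>v / u\<close> will be the derivative of \<open>g\<close> composed with the inverse of
  \<open>\<phi>\<close>.\<close>

lemma one_plus_Re_divide_pos_iff:
  fixes u v :: complex
  assumes "u \<noteq> 0"
  shows "0 < 1 + 2 * Re (v / u) \<longleftrightarrow> 0 < (cmod u)\<^sup>2 + 2 * Re (cnj u * v)"
proof -
  have "(cmod u)\<^sup>2 > 0"
    using assms by simp
  moreover have "Re (v / u) = Re (cnj u * v) / (cmod u)\<^sup>2"
    by (simp add: Re_divide cmod_power2 algebra_simps)
  ultimately have "(cmod u)\<^sup>2 + 2 * Re (cnj u * v) = (cmod u)\<^sup>2 * (1 + 2 * Re (v / u))"
    by (simp add: field_simps)
  then show ?thesis
    using \<open>(cmod u)\<^sup>2 > 0\<close> by (simp only: zero_less_mult_iff) auto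
qed

lemma horizontal_section_between:
  assumes "connected (\<Omega> \<inter> {w. Im w = y})" "Complex a y \<in> \<Omega>" "Complex b y \<in> \<Omega>" "a \<le> x" "x \<le> b"
  shows "Complex x y \<in> \<Omega>"
proof -
  have "connected (Re ` (\<Omega> \<inter> {w. Im w = y}))"
    using assms(1) by (intro connected_continuous_image continuous_intros)
  moreover have "a \<in> Re ` (\<Omega> \<inter> {w. Im w = y})" "b \<in> Re ` (\<Omega> \<inter> {w. Im w = y})"
    using assms(2,3) by (force intro: rev_image_eqI)+
  ultimately have "x \<in> Re ` (\<Omega> \<inter> {w. Im w = y})"
    using assms(4,5) unfolding connected_iff_interval by blast
  then obtain w where "w \<in> \<Omega>" "Im w = y" "Re w = x"
    by auto
  then show ?thesis
    using complex_surj[of w] by simp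
qed

text \<open>\<open>F\<close> preserves imaginary parts, so it acts on each horizontal line
  separately; there \<open>1 + 2 * Re (deriv G w)\<close> is the derivative of its real
  part.\<close>

lemma horizontal_shear:
  assumes dom: "domain_convex_real_dir \<Omega>" and hol: "G holomorphic_on \<Omega>"
    and pos: "\<And>w. w \<in> \<Omega> \<Longrightarrow> 0 < 1 + 2 * Re (deriv G w)"
  defines "F \<equiv> \<lambda>w. w + complex_of_real (2 * Re (G w))"
  shows "inj_on F \<Omega>" "domain_convex_real_dir (F ` \<Omega>)"
proof -
  have op: "open \<Omega>" and con: "connected \<Omega>" and ne: "\<Omega> \<noteq> {}"
    and sec: "\<And>y. connected (\<Omega> \<inter> {w. Im w = y})"
    using dom by (auto simp: domain_convex_real_dir_def)
  have ImF: "Im (F w) = Im w" for w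
    by (simp add: F_def)
  have mono: "Re (F (Complex a y)) < Re (F (Complex b y))"
    if ab: "a < b" "Complex a y \<in> \<Omega>" "Complex b y \<in> \<Omega>" for a b y
  proof (rule DERIV_pos_imp_increasing[OF ab(1)])
    fix x assume "a \<le> x" "x \<le> b"
    \<comment> \<open>Convexity in the real direction enters here: the whole segment between the two
      points lies in the domain, so the derivative is positive all along it.\<close>
    then have mem: "Complex x y \<in> \<Omega>"
      using horizontal_section_between[OF sec] ab by blast
    have line: "((\<lambda>x. Complex x y) has_vector_derivative 1) (at x)"
      unfolding Complex_eq by (auto intro!: derivative_eq_intros)
    have "(G has_field_derivative deriv G (Complex x y)) (at (Complex x y))"
      using holomorphic_derivI[OF hol op mem] .
    from field_vector_diff_chain_at[OF line this]
    have "((\<lambda>x. G (Complex x y)) has_vector_derivative deriv G (Complex x y)) (at x)"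
      by (simp add: o_def)
    then have "((\<lambda>x. Re (G (Complex x y))) has_real_derivative Re (deriv G (Complex x y))) (at x)"
      by (rule has_vector_derivative_complex_iff[THEN iffD1, THEN conjunct1])
    from DERIV_add[OF DERIV_ident DERIV_cmult[OF this, of 2]]
    have "((\<lambda>x. Re (F (Complex x y))) has_real_derivative
        1 + 2 * Re (deriv G (Complex x y))) (at x)"
      by (simp add: F_def)
    then show "\<exists>d. ((\<lambda>x. Re (F (Complex x y))) has_real_derivative d) (at x) \<and> 0 < d"
      using pos[OF mem] by blast
  qed
  show inj: "inj_on F \<Omega>"
  proof (rule inj_onI)
    fix v w assume vw: "v \<in> \<Omega>" "w \<in> \<Omega>" "F v = F w"
    then have im: "Im v = Im w"
      by (metis ImF)
    moreover have "Re v = Re w"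
      using mono[of "Re v" "Re w" "Im w"] mono[of "Re w" "Re v" "Im w"] vw im
      by (metis complex_surj less_irrefl linorder_neqE_linordered_idom)
    ultimately show "v = w"
      by (simp add: complex_eq_iff)
  qed
  have cont: "continuous_on \<Omega> F"
    unfolding F_def using holomorphic_on_imp_continuous_on[OF hol] by (intro continuous_intros)
  have "F ` \<Omega> \<inter> {w. Im w = y} = F ` (\<Omega> \<inter> {w. Im w = y})" for y
    using ImF by auto
  moreover have "connected (F ` (\<Omega> \<inter> {w. Im w = y}))" for y
    using cont sec by (intro connected_continuous_image) (auto intro: continuous_on_subset)
  \<comment> \<open>\<open>F\<close> need not be holomorphic, so openness comes from continuity and
    injectivity instead of the open mapping theorem.\<close>
  moreover have "open (F ` \<Omega>)"
    using invariance_of_domain[OF cont op inj] .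
  ultimately show "domain_convex_real_dir (F ` \<Omega>)"
    using connected_continuous_image[OF cont con] ne by (simp add: domain_convex_real_dir_def)
qed

text \<open>Substituting \<open>h = \<phi> + g\<close> into \<open>h + cnj g\<close> leaves
  \<open>\<phi>\<close> plus the real term \<open>g + cnj g\<close>; the same substitution in
  \<open>|g'| < |h'|\<close> yields the affine inequality.\<close>

lemma class_W_minus_one_shear:
  assumes W: "f \<in> class_W (-1) \<phi>" and S: "sense_preserving_on f unit_disc"
  obtains g where "g holomorphic_on unit_disc"
    and "\<And>z. z \<in> unit_disc \<Longrightarrow> f z = \<phi> z + complex_of_real (2 * Re (g z))"
    and "\<And>z. z \<in> unit_disc \<Longrightarrow> 0 < (cmod (deriv \<phi> z))\<^sup>2 + 2 * Re (cnj (deriv \<phi> z) * deriv g z)"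
proof -
  obtain h g where rep: "canonical_rep f h g"
    and sum: "\<And>z. z \<in> unit_disc \<Longrightarrow> h z - g z = \<phi> z"
    using W by (auto simp: class_W_def)
  have hol: "h holomorphic_on unit_disc" "g holomorphic_on unit_disc"
    and f: "\<And>z. z \<in> unit_disc \<Longrightarrow> f z = h z + cnj (g z)"
    using rep by (auto simp: canonical_rep_def)
  show thesis
  proof (rule that[OF hol(2)])
    fix z assume z: "z \<in> unit_disc"
    show "f z = \<phi> z + complex_of_real (2 * Re (g z))"
      using f[OF z] sum[OF z, symmetric] by (simp add: complex_eq_iff)
    have "((\<lambda>z. h z - g z) has_field_derivative deriv h z - deriv g z) (at z)"
      using hol z by (auto intro!: derivative_intros holomorphic_derivI)
    then have "(\<phi> has_field_derivative deriv h z - deriv g z) (at z)"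
      by (rule has_field_derivative_transform_within_open[where S = unit_disc])
        (use sum z in auto)
    then have "deriv h z = deriv \<phi> z + deriv g z"
      by (simp add: DERIV_imp_deriv)
    moreover have "cmod (deriv g z) < cmod (deriv h z)"
      using S z wirtinger_canonical_rep[OF rep z] by (metis complex_mod_cnj sense_preserving_on_def)
    ultimately show "0 < (cmod (deriv \<phi> z))\<^sup>2 + 2 * Re (cnj (deriv \<phi> z) * deriv g z)"
      using norm_less_norm_add_iff by simp
  qed
qed

theorem theorem2:
  fixes \<phi> f1 f2 f3 :: "complex \<Rightarrow> complex" and t :: real
  assumes "\<phi> \<in> class_A"
    and "f1 \<in> class_SH0" and "f2 \<in> class_SH0"
    and "f1 \<in> class_W (-1) \<phi>" and "f2 \<in> class_W (-1) \<phi>"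
    and "inj_on \<phi> unit_disc" and "convex_real_dir \<phi>"
    and "0 \<le> t" and "t \<le> 1"
    and "f3 = (\<lambda>z. of_real t * f1 z + of_real (1 - t) * f2 z)"
  shows "inj_on f3 unit_disc \<and> convex_real_dir f3"
proof -
  let ?J = "\<lambda>k z. (cmod (deriv \<phi> z))\<^sup>2 + 2 * Re (cnj (deriv \<phi> z) * k)"
  obtain g1 where g1: "g1 holomorphic_on unit_disc"
    and f1: "\<And>z. z \<in> unit_disc \<Longrightarrow> f1 z = \<phi> z + complex_of_real (2 * Re (g1 z))"
    and J1: "\<And>z. z \<in> unit_disc \<Longrightarrow> 0 < ?J (deriv g1 z) z"
    using class_W_minus_one_shear[OF assms(4)] assms(2) by (auto simp: class_SH0_def)
  obtain g2 where g2: "g2 holomorphic_on unit_disc"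
    and f2: "\<And>z. z \<in> unit_disc \<Longrightarrow> f2 z = \<phi> z + complex_of_real (2 * Re (g2 z))"
    and J2: "\<And>z. z \<in> unit_disc \<Longrightarrow> 0 < ?J (deriv g2 z) z"
    using class_W_minus_one_shear[OF assms(5)] assms(3) by (auto simp: class_SH0_def)
  define g where "g = (\<lambda>z. of_real t * g1 z + of_real (1 - t) * g2 z)"
  have g: "g holomorphic_on unit_disc"
    unfolding g_def by (intro holomorphic_intros g1 g2)
  have f3: "f3 z = \<phi> z + complex_of_real (2 * Re (g z))" if "z \<in> unit_disc" for z
    using f1[OF that] f2[OF that] by (simp add: assms(10) g_def complex_eq_iff algebra_simps)
  have J: "0 < ?J (deriv g z) z" if z: "z \<in> unit_disc" for z
  proof -
    have "(g has_field_derivative of_real t * deriv g1 z + of_real (1 - t) * deriv g2 z) (at z)"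
      unfolding g_def using g1 g2 z by (auto intro!: derivative_eq_intros holomorphic_derivI)
    then have g': "deriv g z = of_real t * deriv g1 z + of_real (1 - t) * deriv g2 z"
      by (rule DERIV_imp_deriv)
    \<comment> \<open>The weights sum to 1, so the constant term \<open>|\<phi>'|^2\<close> is
      reproduced exactly.\<close>
    have "?J (deriv g z) z = t * ?J (deriv g1 z) z + (1 - t) * ?J (deriv g2 z) z"
      unfolding g' by (simp add: algebra_simps)
    \<comment> \<open>For \<open>t = 0\<close> the second summand carries the strict sign; otherwise
      the first does, and the second is merely nonnegative.\<close>
    also have "\<dots> > 0"
      using J1[OF z] J2[OF z] assms(8,9)
      by (cases "t = 0") (auto intro!: add_pos_nonneg mult_pos_pos mult_nonneg_nonneg)
    finally show ?thesis .
  qed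
  have \<phi>: "\<phi> holomorphic_on unit_disc"
    using assms(1) by (simp add: class_A_def)
  \<comment> \<open>Univalence of \<open>\<phi>\<close> supplies a holomorphic inverse on the image;
    the product formula also shows that \<open>\<phi>'\<close> never vanishes.\<close>
  obtain \<psi> where \<psi>: "\<psi> holomorphic_on \<phi> ` unit_disc"
    and \<psi>': "\<And>z. z \<in> unit_disc \<Longrightarrow> deriv \<phi> z * deriv \<psi> (\<phi> z) = 1"
    and inv: "\<And>z. z \<in> unit_disc \<Longrightarrow> \<psi> (\<phi> z) = z"
    using holomorphic_has_inverse[OF \<phi> open_ball assms(6)] by metis
  define G where "G = g \<circ> \<psi>"
  define F where "F = (\<lambda>w. w + complex_of_real (2 * Re (G w)))"
  have dom: "domain_convex_real_dir (\<phi> ` unit_disc)"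
    using assms(7) by (simp add: convex_real_dir_def)
  then have op: "open (\<phi> ` unit_disc)"
    by (simp add: domain_convex_real_dir_def)
  have G: "G holomorphic_on \<phi> ` unit_disc"
    unfolding G_def by (rule holomorphic_on_compose_gen[OF \<psi> g]) (use inv in auto)
  have "0 < 1 + 2 * Re (deriv G w)" if w: "w \<in> \<phi> ` unit_disc" for w
  proof -
    obtain z where z: "z \<in> unit_disc" "w = \<phi> z"
      using w by auto
    have nz: "deriv \<phi> z \<noteq> 0"
      using \<psi>'[OF z(1)] by auto
    have "(g has_field_derivative deriv g z) (at (\<psi> w))"
      using holomorphic_derivI[OF g open_ball z(1)] inv[OF z(1)] z(2) by simp
    then have "(G has_field_derivative deriv g z * deriv \<psi> w) (at w)"
      unfolding G_def by (rule DERIV_chain) (rule holomorphic_derivI[OF \<psi> op w])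
    moreover have "deriv \<psi> w = 1 / deriv \<phi> z"
      using \<psi>'[OF z(1)] z(2) nz by (simp add: field_simps)
    ultimately have "deriv G w = deriv g z / deriv \<phi> z"
      by (simp add: DERIV_imp_deriv)
    then show ?thesis
      using J[OF z(1)] one_plus_Re_divide_pos_iff[OF nz] by simp
  qed
  note shear = horizontal_shear[OF dom G this, folded F_def]
  have F: "f3 z = F (\<phi> z)" if "z \<in> unit_disc" for z
    using f3[OF that] inv[OF that] by (simp add: F_def G_def)
  have "inj_on (F \<circ> \<phi>) unit_disc"
    using comp_inj_on[OF assms(6) shear(1)] .
  then have "inj_on f3 unit_disc"
    using F by (simp add: inj_on_def)
  moreover have "f3 ` unit_disc = F ` \<phi> ` unit_disc"
    using F by (simp add: image_image)
  ultimately show ?thesis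
    using shear(2) by (simp add: convex_real_dir_def)
qed

end
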